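(* Let $(X,d)$ be a metric space. The following three conditions are equivalent. 1. There exists an ultrametric $\rho$ on $X$ which is topologically equivalent to $d$. 2. $(X,d)$ has covering dimension zero. 3. There exists a sequence $\{\mathcal{U}_i : i\in\omega\}$ of pairwise disjoint open covers of $X$ such that (i) for every $i\in\omega$, if $U\in\mathcal{U}_i$ then $\operatorname{diam}(U)\le 2^{-(i+1)}$, and (ii) $\mathcal{U}_{i+1}$ refines $\mathcal{U}_i$ for all $i\in\omega$.
   Context: $\omega$ denotes the set of non-negative integers. A metric $\rho$ on $X$ is an ultrametric if $\rho(x,z)\le\max\{\rho(x,y),\rho(y,z)\}$ for all $x,y,z\in X$. Two metrics on $X$ are topologically equivalent if they induce the same topology on $X$. A family $\mathcal{V}$ of subsets of $X$ refines a family $\mathcal{U}$ if for every $V\in\mathcal{V}$ there is $U\in\mathcal{U}$ with $V\subset U$. A family $\mathcal{U}$ (in particular, a cover) is pairwise disjoint if any two distinct members of it are disjoint. An open cover of $X$ is a family of open subsets of $X$ whose union is $X$. A metric space $(X,d)$ has covering dimension zero if for every open cover $\mathcal{U}$ of $X$ there is a pairwise disjoint open cover $\mathcal{V}$ of $X$ such that $\mathcal{V}$ refines $\mathcal{U}$. The diameter is $\operatorname{diam}(U)=\sup\{d(x,y):x,y\in U\}$, computed in the metric $d$. *)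

theory Defs
  imports "HOL-Analysis.Analysis"
begin

definition ultrametric :: "'a set \<Rightarrow> ('a \<Rightarrow> 'a \<Rightarrow> real) \<Rightarrow> bool" where
  "ultrametric X \<rho> \<longleftrightarrow> Metric_space X \<rho> \<and>
     (\<forall>x\<in>X. \<forall>y\<in>X. \<forall>z\<in>X. \<rho> x z \<le> max (\<rho> x y) (\<rho> y z))"

definition topologically_equivalent ::
  "'a set \<Rightarrow> ('a \<Rightarrow> 'a \<Rightarrow> real) \<Rightarrow> ('a \<Rightarrow> 'a \<Rightarrow> real) \<Rightarrow> bool" where
  "topologically_equivalent X d \<rho> \<longleftrightarrow>
     Metric_space.mtopology X d = Metric_space.mtopology X \<rho>"

(* Unlike the library constant refines, which relates partitions of a fixed set,
   this concerns arbitrary families; the refining family comes first. *)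
definition family_refines :: "'a set set \<Rightarrow> 'a set set \<Rightarrow> bool" where
  "family_refines \<V> \<U> \<longleftrightarrow> (\<forall>V\<in>\<V>. \<exists>U\<in>\<U>. V \<subseteq> U)"

definition open_cover :: "'a topology \<Rightarrow> 'a set set \<Rightarrow> bool" where
  "open_cover T \<U> \<longleftrightarrow> (\<forall>U\<in>\<U>. openin T U) \<and> \<Union>\<U> = topspace T"

definition covering_dimension_zero :: "'a set \<Rightarrow> ('a \<Rightarrow> 'a \<Rightarrow> real) \<Rightarrow> bool" where
  "covering_dimension_zero X d \<longleftrightarrow>
     (\<forall>\<U>. open_cover (Metric_space.mtopology X d) \<U> \<longrightarrow>
        (\<exists>\<V>. open_cover (Metric_space.mtopology X d) \<V> \<and> disjoint \<V> \<and> family_refines \<V> \<U>))"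

(* Taken in the extended non-negative reals, so that an unbounded set has infinite
   diameter and the empty set has diameter 0. *)
definition metric_diam :: "('a \<Rightarrow> 'a \<Rightarrow> real) \<Rightarrow> 'a set \<Rightarrow> ennreal" where
  "metric_diam d U = (SUP x\<in>U. SUP y\<in>U. ennreal (d x y))"

end

theory Submission
  imports Defs
begin

text \<open>
  An ultrametric and a refining sequence of disjoint covers of vanishing mesh carry the same
  information.  In an ultrametric space the balls of a fixed radius partition the space, and the
  partition into balls of radius \<open>1 / 2 ^ (n + 1)\<close> refines the one into balls of radius
  \<open>1 / 2 ^ n\<close>.  Conversely, a refining sequence of partitions is a tree in which every point
  determines a branch.  If the mesh tends to zero, distinct points have distinct branches, and the
  distance read off from the level at which two branches separate is an ultrametric
  (\<open>ultrametric_separation_dist\<close>).  Its balls of radius \<open>1 / 2 ^ n\<close> are the members of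
  the \<open>n\<close>-th partition, so openness of the members and vanishing mesh with respect to \<open>d\<close> make it
  topologically equivalent to \<open>d\<close> (\<open>mtopology_separation_dist\<close>).

  Covering dimension zero fits in between.  It yields the sequence of partitions by repeatedly
  refining the previous partition intersected with small balls
  (\<open>disjoint_refinement_small_diam\<close>).  It follows from an ultrametric because two balls that meet
  are nested: given an open cover, take around each point the largest ball of radius
  \<open>1 / 2 ^ n\<close> that fits into a member of the cover; maximality turns nesting into equality
  (\<open>ultrametric_imp_disjoint_refinement\<close>).
\<close>

section \<open>Ultrametrics have covering dimension zero\<close>

text \<open>
  By the strong triangle inequality, two points at distance less than \<open>r\<close> from a third are at
  distance less than \<open>r\<close> from each other; so every point of a ball is a centre of it, and two
  balls that meet can be recentred at a common point.
\<close>

lemma ultrametric_mball_eq: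
  assumes "ultrametric X \<rho>" and "y \<in> Metric_space.mball X \<rho> x r"
  shows "Metric_space.mball X \<rho> y r = Metric_space.mball X \<rho> x r"
proof -
  interpret Metric_space X \<rho> using assms(1) by (simp add: ultrametric_def)
  have ult: "\<rho> a c < r" if "\<rho> a b < r" "\<rho> b c < r" "a \<in> X" "b \<in> X" "c \<in> X" for a b c
    using assms(1) that unfolding ultrametric_def by (meson le_less_trans max_less_iff_conj)
  have xy: "x \<in> X" "y \<in> X" "\<rho> x y < r" "\<rho> y x < r"
    using assms(2) commute[of x y] by auto
  show ?thesis
    using xy by (auto intro: ult)
qed

text \<open>
  The level chosen for a point is the least one whose ball fits into a member of the cover.  If
  two of the chosen balls meet, the larger one contains the centre of the smaller one and is
  therefore a candidate for that centre too, so the levels, and with them the balls, agree.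
\<close>

lemma ultrametric_imp_disjoint_refinement:
  assumes um: "ultrametric X \<rho>" and cover: "open_cover (Metric_space.mtopology X \<rho>) \<U>"
  shows "\<exists>\<V>. open_cover (Metric_space.mtopology X \<rho>) \<V> \<and> disjoint \<V> \<and> family_refines \<V> \<U>"
proof -
  interpret Metric_space X \<rho> using um by (simp add: ultrametric_def)
  define fits where "fits x n \<longleftrightarrow> (\<exists>U\<in>\<U>. mball x (1 / 2 ^ n) \<subseteq> U)" for x and n :: nat
  define lev where "lev x = (LEAST n. fits x n)" for x
  define B where "B x = mball x (1 / 2 ^ lev x)" for x
  have ex: "\<exists>n. fits x n" if x: "x \<in> X" for x
  proof -
    obtain U where U: "U \<in> \<U>" "x \<in> U" "openin mtopology U"
      using cover x unfolding open_cover_def topspace_mtopology by blast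
    then obtain r where r: "r > 0" "mball x r \<subseteq> U"
      by (auto simp: openin_mtopology)
    obtain n where "(1 / 2) ^ n < r"
      using real_arch_pow_inv[of r "1 / 2"] r by auto
    then have "mball x (1 / 2 ^ n) \<subseteq> U"
      using r mball_subset_concentric[of "1 / 2 ^ n" r x] by (simp add: power_one_over)
    then show ?thesis using U by (auto simp: fits_def)
  qed
  have fits_lev: "fits x (lev x)" if "x \<in> X" for x
    unfolding lev_def by (rule LeastI_ex) (rule ex[OF that])
  have mem: "x \<in> B x" if "x \<in> X" for x
    using that by (simp add: B_def)
  have eq: "B x = B y" if "x \<in> X" "y \<in> X" "z \<in> B x" "z \<in> B y" "lev x \<le> lev y" for x y z
  proof -
    have "mball x (1 / 2 ^ lev x) = mball z (1 / 2 ^ lev x)"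
      by (rule ultrametric_mball_eq[OF um that(3)[unfolded B_def], symmetric])
    moreover have "y \<in> mball z (1 / 2 ^ lev x)"
    proof -
      have "y \<in> mball z (1 / 2 ^ lev y)"
        unfolding ultrametric_mball_eq[OF um that(4)[unfolded B_def]] using that(2) by simp
      moreover have "(1::real) / 2 ^ lev y \<le> 1 / 2 ^ lev x"
        using that(5) by (simp add: frac_le)
      ultimately show ?thesis
        using mball_subset_concentric by blast
    qed
    ultimately have same: "mball y (1 / 2 ^ lev x) = mball x (1 / 2 ^ lev x)"
      using ultrametric_mball_eq[OF um, of y z "1 / 2 ^ lev x"] by simp
    \<comment> \<open>The ball of \<open>x\<close>, recentred at \<open>y\<close>, competes in the choice of the level of \<open>y\<close>.\<close>
    have "fits y (lev x)"
      using fits_lev[OF that(1)] same by (simp add: fits_def)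
    then have "lev y \<le> lev x"
      by (simp add: lev_def[of y] Least_le)
    then show ?thesis
      using that(5) same by (simp add: B_def)
  qed
  have "open_cover mtopology (B ` X)"
    using mem by (auto simp: open_cover_def B_def)
  moreover have "disjoint (B ` X)"
  proof (rule disjointI)
    fix a b assume "a \<in> B ` X" "b \<in> B ` X" "a \<noteq> b"
    then show "a \<inter> b = {}"
      using eq by (metis disjoint_iff imageE linear)
  qed
  moreover have "family_refines (B ` X) \<U>"
    using fits_lev by (auto simp: family_refines_def fits_def B_def)
  ultimately show ?thesis by blast
qed

section \<open>Disjoint covers of small mesh\<close>

lemma dist_le_metric_diam:
  assumes "x \<in> U" and "y \<in> U"
  shows "ennreal (d x y) \<le> metric_diam d U"
  unfolding metric_diam_def using assms by (meson SUP_upper2 order_refl)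

text \<open>
  Intersecting the cover with balls of radius \<open>e / 2\<close> before refining it bounds the diameters
  and preserves the refinement; this is the step of the recursion that produces the sequence.
\<close>

lemma disjoint_refinement_small_diam:
  assumes M: "Metric_space X d" and dim: "covering_dimension_zero X d"
    and \<U>: "open_cover (Metric_space.mtopology X d) \<U>" and e: "e > 0"
  shows "\<exists>\<V>. open_cover (Metric_space.mtopology X d) \<V> \<and> disjoint \<V> \<and> family_refines \<V> \<U> \<and>
           (\<forall>V\<in>\<V>. metric_diam d V \<le> ennreal e)"
proof -
  interpret Metric_space X d by fact
  define \<W> where "\<W> = (\<lambda>(U, x). U \<inter> mball x (e / 2)) ` (\<U> \<times> X)"
  have "open_cover mtopology \<W>"
    unfolding open_cover_def
  proof (intro conjI ballI)
    fix W assume "W \<in> \<W>"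
    then obtain U x where "U \<in> \<U>" "W = U \<inter> mball x (e / 2)"
      by (auto simp: \<W>_def)
    then show "openin mtopology W"
      using \<U> by (simp add: open_cover_def openin_Int)
  next
    have "x \<in> \<Union>\<W>" if x: "x \<in> X" for x
    proof -
      obtain U where "U \<in> \<U>" "x \<in> U"
        using \<U> x by (auto simp: open_cover_def)
      moreover have "x \<in> mball x (e / 2)"
        using x e by simp
      ultimately show ?thesis
        using x unfolding \<W>_def by force
    qed
    then show "\<Union>\<W> = topspace mtopology"
      by (auto simp: \<W>_def)
  qed
  then obtain \<V> where \<V>: "open_cover mtopology \<V>" "disjoint \<V>" "family_refines \<V> \<W>"
    using dim by (auto simp: covering_dimension_zero_def)
  have "metric_diam d V \<le> ennreal e" if V: "V \<in> \<V>" for V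
  proof -
    obtain c where c: "V \<subseteq> mball c (e / 2)"
      using \<V>(3) V by (fastforce simp: family_refines_def \<W>_def)
    have "d x y \<le> e" if "x \<in> V" "y \<in> V" for x y
    proof -
      have "c \<in> X" "x \<in> X" "y \<in> X" "d c x < e / 2" "d c y < e / 2"
        using c that by auto
      then show ?thesis
        using triangle[of x c y] commute[of c x] by simp
    qed
    then show ?thesis
      unfolding metric_diam_def by (intro SUP_least) (simp add: ennreal_leI)
  qed
  moreover have "family_refines \<V> \<U>"
    using \<V>(3) by (fastforce simp: family_refines_def \<W>_def)
  ultimately show ?thesis
    using \<V> by blast
qed

section \<open>The ultrametric of a refining sequence of partitions\<close>

definition same_cell :: "'a set set \<Rightarrow> 'a \<Rightarrow> 'a \<Rightarrow> bool" where
  "same_cell \<U> x y \<longleftrightarrow> (\<exists>U\<in>\<U>. x \<in> U \<and> y \<in> U)"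

text \<open>
  Meant for covers that separate points: for distinct points that share a cell at every level the
  exponent is an unspecified number.
\<close>

definition separation_dist :: "(nat \<Rightarrow> 'a set set) \<Rightarrow> 'a \<Rightarrow> 'a \<Rightarrow> real" where
  "separation_dist \<U> x y =
     (if x = y then 0 else 1 / 2 ^ (LEAST n. \<not> same_cell (\<U> n) x y))"

lemma same_cell_commute: "same_cell \<U> x y \<longleftrightarrow> same_cell \<U> y x"
  by (auto simp: same_cell_def)

lemma same_cell_trans:
  assumes "disjoint \<U>" "same_cell \<U> x y" "same_cell \<U> y z"
  shows "same_cell \<U> x z"
  using assms unfolding same_cell_def disjoint_def by blast

text \<open>
  A refining sequence of partitions of a bare set in which distinct points have distinct branches.
  The last assumption makes the level at which two points separate well defined.
\<close>

context
  fixes X :: "'a set" and \<U> :: "nat \<Rightarrow> 'a set set"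
  assumes covers: "\<And>n. \<Union>(\<U> n) = X"
    and disj: "\<And>n. disjoint (\<U> n)"
    and refines: "\<And>n. family_refines (\<U> (Suc n)) (\<U> n)"
    and separates: "\<And>x y. x \<in> X \<Longrightarrow> y \<in> X \<Longrightarrow> x \<noteq> y \<Longrightarrow> \<exists>n. \<not> same_cell (\<U> n) x y"
begin

lemma same_cell_antimono:
  assumes "m \<le> n" and "same_cell (\<U> n) x y"
  shows "same_cell (\<U> m) x y"
  using assms
proof (induction rule: dec_induct)
  case (step k)
  then obtain V where "V \<in> \<U> (Suc k)" "x \<in> V" "y \<in> V"
    by (auto simp: same_cell_def)
  moreover from this obtain U where "U \<in> \<U> k" "V \<subseteq> U"
    using refines[of k] by (auto simp: family_refines_def)
  ultimately have "same_cell (\<U> k) x y"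
    by (auto simp: same_cell_def)
  then show ?case
    by (rule step.IH)
qed

text \<open>So the ball of radius \<open>1 / 2 ^ n\<close> around a point is its cell in the \<open>n\<close>-th partition.\<close>

lemma separation_dist_less_iff:
  assumes "x \<in> X" and "y \<in> X"
  shows "separation_dist \<U> x y < 1 / 2 ^ n \<longleftrightarrow> same_cell (\<U> n) x y"
proof (cases "x = y")
  case True
  then show ?thesis
    using covers[of n] assms by (auto simp: separation_dist_def same_cell_def)
next
  case False
  define k where "k = (LEAST n. \<not> same_cell (\<U> n) x y)"
  have k: "\<not> same_cell (\<U> k) x y"
    unfolding k_def by (rule LeastI_ex) (rule separates[OF assms False])
  have "same_cell (\<U> m) x y" if "m < k" for m
    using not_less_Least that unfolding k_def by blast
  then have "same_cell (\<U> n) x y \<longleftrightarrow> n < k"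
    using k same_cell_antimono[of k n x y] by (meson not_less)
  then show ?thesis
    using False by (simp add: separation_dist_def k_def[symmetric] divide_simps)
qed

lemma ultrametric_separation_dist: "ultrametric X (separation_dist \<U>)"
proof -
  let ?\<rho> = "separation_dist \<U>"
  have nonneg: "0 \<le> ?\<rho> x y" for x y
    by (simp add: separation_dist_def)
  have ult: "?\<rho> x z \<le> max (?\<rho> x y) (?\<rho> y z)" if X: "x \<in> X" "y \<in> X" "z \<in> X" for x y z
  proof (rule ccontr)
    assume less: "\<not> ?thesis"
    then have "x \<noteq> z"
      using nonneg[of x y] by (auto simp: separation_dist_def)
    \<comment> \<open>Positive distances are powers of \<open>1 / 2\<close>, so a strict inequality between them
      can be tested on cells.\<close>
    then obtain n where n: "?\<rho> x z = 1 / 2 ^ n"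
      by (auto simp: separation_dist_def)
    then have "?\<rho> x y < 1 / 2 ^ n" "?\<rho> y z < 1 / 2 ^ n"
      using less by simp_all
    then have "same_cell (\<U> n) x y" "same_cell (\<U> n) y z"
      using X separation_dist_less_iff by blast+
    then have "same_cell (\<U> n) x z"
      using same_cell_trans disj by metis
    then have "?\<rho> x z < 1 / 2 ^ n"
      using separation_dist_less_iff X by blast
    then show False
      using n by simp
  qed
  have "Metric_space X ?\<rho>"
  proof
    show "?\<rho> x y = ?\<rho> y x" for x y
      by (auto simp: separation_dist_def same_cell_commute)
    show "?\<rho> x y = 0 \<longleftrightarrow> x = y" for x y
      by (simp add: separation_dist_def)
    show "?\<rho> x z \<le> ?\<rho> x y + ?\<rho> y z" if "x \<in> X" "y \<in> X" "z \<in> X" for x y z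
      using ult[OF that] nonneg[of x y] nonneg[of y z] by linarith
  qed (rule nonneg)
  then show ?thesis
    using ult by (auto simp: ultrametric_def)
qed

end

lemma same_cell_imp_dist_le:
  assumes mesh: "\<And>U. U \<in> \<U> \<Longrightarrow> metric_diam d U \<le> ennreal e"
    and e: "0 \<le> e" and xy: "same_cell \<U> x y"
  shows "d x y \<le> e"
proof -
  obtain U where "U \<in> \<U>" "x \<in> U" "y \<in> U"
    using xy by (auto simp: same_cell_def)
  then have "ennreal (d x y) \<le> ennreal e"
    using mesh dist_le_metric_diam order_trans by meson
  then show ?thesis
    using e by (simp add: ennreal_le_iff)
qed

text \<open>
  Every ball of either metric contains a cell around its centre: for \<open>d\<close> because the mesh tends to
  zero, for the separation distance because its balls are cells.  As cells are open for both
  metrics, they form a common base.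
\<close>

lemma mtopology_separation_dist:
  fixes \<U> :: "nat \<Rightarrow> 'a set set"
  assumes M: "Metric_space X d"
    and covers: "\<And>n. open_cover (Metric_space.mtopology X d) (\<U> n)"
    and disj: "\<And>n. disjoint (\<U> n)"
    and mesh: "\<And>n U. U \<in> \<U> n \<Longrightarrow> metric_diam d U \<le> ennreal (1 / 2 ^ (n + 1))"
    and refines: "\<And>n. family_refines (\<U> (Suc n)) (\<U> n)"
  shows "ultrametric X (separation_dist \<U>)"
    and "topologically_equivalent X d (separation_dist \<U>)"
proof -
  interpret d: Metric_space X d by fact
  let ?\<rho> = "separation_dist \<U>"
  have cover: "\<Union>(\<U> n) = X" and op: "U \<in> \<U> n \<Longrightarrow> openin d.mtopology U" for n U
    using covers[of n] by (auto simp: open_cover_def)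
  have small: "d x y < r" if "same_cell (\<U> n) x y" "(1 / 2) ^ n < r" for x y n r
  proof -
    have "d x y \<le> 1 / 2 ^ (n + 1)"
      using same_cell_imp_dist_le[of "\<U> n" d "1 / 2 ^ (n + 1)"] mesh that(1) by auto
    also have "\<dots> \<le> (1 / 2) ^ n"
      by (simp add: field_simps)
    finally show ?thesis
      using that(2) by simp
  qed
  have arch: "\<exists>n. (1 / 2) ^ n < r" if "r > 0" for r :: real
    using real_arch_pow_inv[of r "1 / 2"] that by auto
  have separates: "\<exists>n. \<not> same_cell (\<U> n) x y" if "x \<in> X" "y \<in> X" "x \<noteq> y" for x y
    using arch[of "d x y"] small[of _ x y "d x y"] that by auto
  note hyps = cover disj refines separates
  show um: "ultrametric X ?\<rho>"
    by (rule ultrametric_separation_dist) (fact hyps)+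
  interpret \<rho>: Metric_space X ?\<rho>
    using um by (simp add: ultrametric_def)
  have ball: "?\<rho> x y < 1 / 2 ^ n \<longleftrightarrow> same_cell (\<U> n) x y" if "x \<in> X" "y \<in> X" for x y n
    by (rule separation_dist_less_iff) (fact hyps that)+
  have "openin d.mtopology S \<longleftrightarrow> openin \<rho>.mtopology S" for S
  proof
    assume S: "openin d.mtopology S"
    show "openin \<rho>.mtopology S"
      unfolding \<rho>.openin_mtopology
    proof (intro conjI allI impI)
      show "S \<subseteq> X"
        using S by (simp add: d.openin_mtopology)
      fix x assume "x \<in> S"
      then obtain r where r: "r > 0" "d.mball x r \<subseteq> S"
        using S by (auto simp: d.openin_mtopology)
      obtain n where n: "(1 / 2) ^ n < r"
        using arch[OF r(1)] by blast
      have "\<rho>.mball x (1 / 2 ^ n) \<subseteq> d.mball x r"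
        using ball small n by auto
      then show "\<exists>r>0. \<rho>.mball x r \<subseteq> S"
        using r(2) by (intro exI[of _ "1 / 2 ^ n"]) auto
    qed
  next
    assume S: "openin \<rho>.mtopology S"
    show "openin d.mtopology S"
    proof (subst openin_subopen, intro ballI)
      fix x assume x: "x \<in> S"
      then have "x \<in> X"
        using S by (auto simp: \<rho>.openin_mtopology)
      obtain r where r: "r > 0" "\<rho>.mball x r \<subseteq> S"
        using S x by (auto simp: \<rho>.openin_mtopology)
      obtain n where n: "(1 / 2) ^ n < r"
        using arch[OF r(1)] by blast
      obtain U where U: "U \<in> \<U> n" "x \<in> U"
        using cover[of n] \<open>x \<in> X\<close> by auto
      have "U \<subseteq> \<rho>.mball x r"
      proof
        fix y assume y: "y \<in> U"
        then have "y \<in> X" and "same_cell (\<U> n) x y"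
          using cover[of n] U by (auto simp: same_cell_def)
        then have "?\<rho> x y < 1 / 2 ^ n"
          using ball \<open>x \<in> X\<close> by blast
        then show "y \<in> \<rho>.mball x r"
          using n \<open>x \<in> X\<close> \<open>y \<in> X\<close> by (simp add: power_one_over)
      qed
      then show "\<exists>T. openin d.mtopology T \<and> x \<in> T \<and> T \<subseteq> S"
        using op[OF U(1)] U(2) r(2) by (intro exI[of _ U] conjI) (assumption | rule order_trans)+
    qed
  qed
  then show "topologically_equivalent X d ?\<rho>"
    unfolding topologically_equivalent_def topology_eq by blast
qed

section \<open>The equivalence\<close>

theorem theorem2p10:
  fixes X :: "'a set" and d :: "'a \<Rightarrow> 'a \<Rightarrow> real"
  assumes "Metric_space X d"
  shows "((\<exists>\<rho>. ultrametric X \<rho> \<and> topologically_equivalent X d \<rho>)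
            \<longleftrightarrow> covering_dimension_zero X d)
       \<and> (covering_dimension_zero X d
            \<longleftrightarrow> (\<exists>\<U> :: nat \<Rightarrow> 'a set set.
                   (\<forall>i. open_cover (Metric_space.mtopology X d) (\<U> i) \<and> disjoint (\<U> i))
                 \<and> (\<forall>i. \<forall>U\<in>\<U> i. metric_diam d U \<le> ennreal (1 / 2 ^ (i + 1)))
                 \<and> (\<forall>i. family_refines (\<U> (Suc i)) (\<U> i))))"
    (is "(?ultra \<longleftrightarrow> ?dim) \<and> (?dim \<longleftrightarrow> ?seq)")
proof -
  interpret Metric_space X d by fact
  have "?ultra \<Longrightarrow> ?dim"
    using ultrametric_imp_disjoint_refinement
    by (fastforce simp: covering_dimension_zero_def topologically_equivalent_def)
  moreover have "?dim \<Longrightarrow> ?seq"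
  proof -
    assume dim: ?dim
    define P where "P n \<U> \<longleftrightarrow> open_cover mtopology \<U> \<and> disjoint \<U> \<and>
        (\<forall>U\<in>\<U>. metric_diam d U \<le> ennreal (1 / 2 ^ (n + 1)))" for n :: nat and \<U>
    have step: "\<exists>\<V>. P n \<V> \<and> family_refines \<V> \<U>" if "open_cover mtopology \<U>" for n \<U>
      using disjoint_refinement_small_diam[OF assms dim that, of "1 / 2 ^ (n + 1)"]
      by (auto simp: P_def)
    have "open_cover mtopology {X}"
      using openin_topspace[of mtopology] by (simp add: open_cover_def)
    then have "\<exists>\<U>. P 0 \<U>"
      by (meson step)
    then have "\<exists>\<U>. \<forall>n. P n (\<U> n) \<and> family_refines (\<U> (Suc n)) (\<U> n)"
      by (rule dependent_nat_choice) (rule step, simp add: P_def)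
    then obtain \<U> where "\<forall>n. P n (\<U> n) \<and> family_refines (\<U> (Suc n)) (\<U> n)" ..
    then show ?seq
      unfolding P_def by (intro exI[of _ \<U>]) simp
  qed
  moreover have "?seq \<Longrightarrow> ?ultra"
  proof -
    assume ?seq
    then obtain \<U> :: "nat \<Rightarrow> 'a set set"
      where covers: "\<forall>i. open_cover mtopology (\<U> i) \<and> disjoint (\<U> i)"
        and mesh: "\<forall>i. \<forall>U\<in>\<U> i. metric_diam d U \<le> ennreal (1 / 2 ^ (i + 1))"
        and refines: "\<forall>i. family_refines (\<U> (Suc i)) (\<U> i)"
      by (elim exE conjE)
    have "ultrametric X (separation_dist \<U>)" "topologically_equivalent X d (separation_dist \<U>)"
      by (rule mtopology_separation_dist[OF assms]; use covers mesh refines in blast)+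
    then show ?ultra by blast
  qed
  ultimately show ?thesis by blast
qed

end
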